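(* Let $k,c>0$, let $\alpha=\frac{k}{4c}$, and consider the function $$\psi(x,t)=\operatorname{sgn}(t)\,\frac{1}{2c}\,I_0\!\left(2\alpha\sqrt{c^2t^2-x^2}\right)\mathcal{X}_{[-c|t|,c|t|]}(x),\qquad (x,t)\in\mathbb{R}\times\mathbb{R}.$$ Then $\psi$ belongs to $\mathcal{C}^1(\mathbb{R},\mathcal{D}'(\mathbb{R}))$ (as the map $t\mapsto\psi(\cdot,t)$) and solves, in the sense of distributions, the initial value problem $$v_{tt}=c^2v_{xx}+\tfrac{k^2}{4}v,\qquad v(0)=0,\qquad v_t(0)=\delta,$$ where $\delta$ is the Dirac delta centered at $x=0$. Furthermore, its time derivative is the distribution $$\psi_t(\cdot,t)=\frac12\left[\delta(\cdot-ct)+\delta(\cdot+ct)\right]+\alpha c|t|\,\frac{I_0'\!\left(2\alpha\sqrt{c^2t^2-\cdot^2}\right)}{\sqrt{c^2t^2-\cdot^2}}\,\mathcal{X}_{[-c|t|,c|t|]}(\cdot).$$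
   Context: $I_0$ is the modified Bessel function of the first kind of order $0$ and $I_0'$ its derivative; the quotient $I_0'(2\alpha z)/z$ is understood by its limit $\alpha$ at $z=0$. $\operatorname{sgn}$ is the sign function, with $\psi(\cdot,0)=0$; $\mathcal{X}_\Omega$ is the characteristic function of $\Omega$ (so $\psi(x,t)=0$ for $|x|>c|t|$). $\mathcal{D}'(\mathbb{R})$ is the space of distributions in $x\in\mathbb{R}$, and $\delta(\cdot-a)$ is the Dirac delta at $x=a$. $\mathcal{C}^1(\mathbb{R},\mathcal{D}'(\mathbb{R}))$ is the space of maps $t\mapsto v(t)\in\mathcal{D}'(\mathbb{R})$ for which there is a map $t\mapsto v_t(t)\in\mathcal{D}'(\mathbb{R})$ such that, for every $\varphi\in\mathcal{C}_0^\infty(\mathbb{R})$ and $t\in\mathbb{R}$, $\left\langle \frac{v(t+h)-v(t)}{h},\varphi\right\rangle\to\langle v_t(t),\varphi\rangle$ and $\langle v_t(t+h),\varphi\rangle\to\langle v_t(t),\varphi\rangle$ as $h\to0$. A $v\in\mathcal{C}^1(\mathbb{R},\mathcal{D}'(\mathbb{R}))$ solves the equation $v_{tt}=c^2v_{xx}+\frac{k^2}{4}v$ in the sense of distributions if the equation holds in $\mathcal{D}'(\mathbb{R}\times\mathbb{R})$, i.e. $\int_{\mathbb{R}}\left\langle v(t),\left(\phi_{tt}-c^2\phi_{xx}-\frac{k^2}{4}\phi\right)(\cdot,t)\right\rangle dt=0$ for all $\phi\in\mathcal{C}_0^\infty(\mathbb{R}^2)$. The initial conditions are equalities in $\mathcal{D}'(\mathbb{R})$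 at $t=0$. *)

theory Defs
  imports "HOL-Analysis.Analysis"
begin

section \<open>Test functions\<close>

primrec C_diff :: "nat \<Rightarrow> ('a::euclidean_space \<Rightarrow> real) \<Rightarrow> bool" where
  "C_diff 0 f \<longleftrightarrow> continuous_on UNIV f"
| "C_diff (Suc n) f \<longleftrightarrow> f differentiable_on UNIV \<and>
     (\<forall>v. C_diff n (\<lambda>x. frechet_derivative f (at x) v))"

definition test_functions :: "('a::euclidean_space \<Rightarrow> real) set" where
  "test_functions = {\<phi>. (\<forall>n. C_diff n \<phi>) \<and> compact (closure {x. \<phi> x \<noteq> 0})}"

text \<open>Convergence in the usual topology on the test functions on the line.\<close>

definition test_converges :: "(nat \<Rightarrow> real \<Rightarrow> real) \<Rightarrow> (real \<Rightarrow> real) \<Rightarrow> bool" where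
  "test_converges \<Phi> \<phi> \<longleftrightarrow>
     (\<exists>K. compact K \<and> (\<forall>n. {x. \<Phi> n x \<noteq> 0} \<subseteq> K)) \<and>
     (\<forall>j. uniform_limit UNIV (\<lambda>n. (deriv ^^ j) (\<Phi> n)) ((deriv ^^ j) \<phi>) sequentially)"


section \<open>Distributions on the line\<close>

text \<open>
  A distribution is represented by a functional on all functions \<open>real \<Rightarrow> real\<close>,
  of which only the values on test functions matter; equality of distributions is therefore
  \<open>distr_eq\<close> and not HOL equality.
\<close>

definition distribution :: "((real \<Rightarrow> real) \<Rightarrow> real) \<Rightarrow> bool" where
  "distribution T \<longleftrightarrow>
     (\<forall>\<phi>\<in>test_functions. \<forall>\<theta>\<in>test_functions. \<forall>a b.
        T (\<lambda>x. a * \<phi> x + b * \<theta> x) = a * T \<phi> + b * T \<theta>) \<and>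
     (\<forall>\<Phi> \<phi>. (\<forall>n. \<Phi> n \<in> test_functions) \<and> \<phi> \<in> test_functions \<and> test_converges \<Phi> \<phi>
        \<longrightarrow> (\<lambda>n. T (\<Phi> n)) \<longlonglongrightarrow> T \<phi>)"

definition distr_eq :: "((real \<Rightarrow> real) \<Rightarrow> real) \<Rightarrow> ((real \<Rightarrow> real) \<Rightarrow> real) \<Rightarrow> bool" where
  "distr_eq S T \<longleftrightarrow> (\<forall>\<phi>\<in>test_functions. S \<phi> = T \<phi>)"

definition dirac :: "real \<Rightarrow> (real \<Rightarrow> real) \<Rightarrow> real" where
  "dirac a \<phi> = \<phi> a"

text \<open>The distribution of a locally integrable function \<open>f\<close>.\<close>

definition regular_distr :: "(real \<Rightarrow> real) \<Rightarrow> (real \<Rightarrow> real) \<Rightarrow> real" where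
  "regular_distr f \<phi> = (LINT x|lborel. f x * \<phi> x)"


section \<open>Distribution-valued functions of time\<close>

definition has_time_derivative ::
    "(real \<Rightarrow> (real \<Rightarrow> real) \<Rightarrow> real) \<Rightarrow> (real \<Rightarrow> (real \<Rightarrow> real) \<Rightarrow> real) \<Rightarrow> bool" where
  "has_time_derivative v w \<longleftrightarrow>
     (\<forall>t. distribution (w t)) \<and>
     (\<forall>\<phi>\<in>test_functions. \<forall>t.
        ((\<lambda>h. (v (t + h) \<phi> - v t \<phi>) / h) \<longlongrightarrow> w t \<phi>) (at 0) \<and>
        ((\<lambda>h. w (t + h) \<phi>) \<longlongrightarrow> w t \<phi>) (at 0))"

definition C1_distr :: "(real \<Rightarrow> (real \<Rightarrow> real) \<Rightarrow> real) \<Rightarrow> bool" where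
  "C1_distr v \<longleftrightarrow> (\<forall>t. distribution (v t)) \<and> (\<exists>w. has_time_derivative v w)"

text \<open>
  The equation \<open>v_tt = c^2 v_xx + (k^2/4) v\<close> in the sense of distributions on the plane,
  whose points are written \<open>(x, t)\<close>. Asking for \<open>has_bochner_integral\<close> excludes the
  default value \<open>0\<close> of the integral of a non-integrable function.
\<close>

definition solves_equation ::
    "real \<Rightarrow> real \<Rightarrow> (real \<Rightarrow> (real \<Rightarrow> real) \<Rightarrow> real) \<Rightarrow> bool" where
  "solves_equation k c v \<longleftrightarrow>
     (\<forall>\<phi> :: real \<times> real \<Rightarrow> real. \<phi> \<in> test_functions \<longrightarrow>
        has_bochner_integral lborel
          (\<lambda>t. v t (\<lambda>x. (deriv ^^ 2) (\<lambda>s. \<phi> (x, s)) t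
                        - c\<^sup>2 * (deriv ^^ 2) (\<lambda>y. \<phi> (y, t)) x
                        - k\<^sup>2 / 4 * \<phi> (x, t))) 0)"

definition solves_ivp ::
    "real \<Rightarrow> real \<Rightarrow> (real \<Rightarrow> (real \<Rightarrow> real) \<Rightarrow> real)
      \<Rightarrow> ((real \<Rightarrow> real) \<Rightarrow> real) \<Rightarrow> ((real \<Rightarrow> real) \<Rightarrow> real) \<Rightarrow> bool" where
  "solves_ivp k c v v0 v1 \<longleftrightarrow>
     solves_equation k c v \<and> distr_eq (v 0) v0 \<and>
     (\<exists>w. has_time_derivative v w \<and> distr_eq (w 0) v1)"


section \<open>The modified Bessel function of the first kind of order zero\<close>

definition bessel_I0 :: "real \<Rightarrow> real" where
  "bessel_I0 z = (\<Sum>n. (z / 2) ^ (2 * n) / (fact n)\<^sup>2)"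

text \<open>The quotient \<open>I_0'(2 \<alpha> z) / z\<close>, continued by its limit \<open>\<alpha>\<close> at \<open>z = 0\<close>.\<close>

definition bessel_I0'_quotient :: "real \<Rightarrow> real \<Rightarrow> real" where
  "bessel_I0'_quotient \<alpha> z = (if z = 0 then \<alpha> else deriv bessel_I0 (2 * \<alpha> * z) / z)"

end

theory Submission
  imports Defs
begin

text \<open>
  Put \<open>F w = I\<^sub>0 (2 \<alpha> \<surd>w)\<close>, an entire function with \<open>w F'' + F' = \<alpha>\<^sup>2 F\<close> and \<open>F 0 = 1\<close>.
  The substitution \<open>x = c t y\<close> turns the pairing of \<open>\<psi>(\<cdot>, t)\<close> with a function \<open>\<phi>\<close> into
  \<open>t / 2\<close> times the integral of \<open>F (c\<^sup>2 t\<^sup>2 (1 - y\<^sup>2)) \<phi>(c t y)\<close> over \<open>y \<in> [-1, 1]\<close>; the domain is now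
  fixed and both signs of \<open>t\<close> are covered at once. Differentiating under the integral and
  integrating by parts in \<open>y\<close> gives \<open>\<psi>\<^sub>t\<close>, the boundary terms being the two Dirac masses.
  For a test function \<open>\<phi>\<close> on the plane, the same computation together with the differential equation
  for \<open>F\<close> shows that \<open>\<langle>\<psi>(t), \<phi>\<^sub>t\<^sub>t - c\<^sup>2 \<phi>\<^sub>x\<^sub>x - k\<^sup>2/4 \<phi>\<rangle>\<close> is the time derivative of
  \<open>\<langle>\<psi>(t), \<phi>\<^sub>t\<rangle> - \<langle>\<psi>\<^sub>t(t), \<phi>\<rangle>\<close>, which has compact support in \<open>t\<close>.
\<close>

section \<open>Weighted means over the light cone\<close>

text \<open>The Jacobian of \<open>x = c t y\<close> is left out, so that \<open>t = 0\<close> is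
  not exceptional; \<open>regular_distr_eq_cone_integral\<close> puts it back as
  \<open>c * \<bar>t\<bar>\<close>.\<close>

definition cone_integral ::
    "real \<Rightarrow> (real \<Rightarrow> real) \<Rightarrow> real \<Rightarrow> (real \<Rightarrow> real) \<Rightarrow> real" where
  "cone_integral c F t \<phi> =
     integral {-1..1} (\<lambda>y. F (c\<^sup>2 * t\<^sup>2 * (1 - y\<^sup>2)) * \<phi> (c * t * y))"

text \<open>With the partial derivatives as explicit arguments, the same lemmas serve functions on
  the plane and, with \<open>qt = 0\<close>, functions of \<open>x\<close> alone.\<close>

definition has_gradient ::
    "(real \<times> real \<Rightarrow> real) \<Rightarrow> (real \<times> real \<Rightarrow> real) \<Rightarrow> (real \<times> real \<Rightarrow> real) \<Rightarrow> bool" where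
  "has_gradient q qx qt \<longleftrightarrow>
     (\<forall>z. (q has_derivative (\<lambda>h. fst h * qx z + snd h * qt z)) (at z)) \<and>
     continuous_on UNIV qx \<and> continuous_on UNIV qt"

lemma has_gradient_DERIV_curve:
  assumes "has_gradient q qx qt"
    and "(a has_real_derivative a') (at s)" and "(b has_real_derivative b') (at s)"
  shows "((\<lambda>s. q (a s, b s)) has_real_derivative
           a' * qx (a s, b s) + b' * qt (a s, b s)) (at s)"
proof -
  have "((\<lambda>s. (a s, b s)) has_derivative (\<lambda>h. (a' * h, b' * h))) (at s)"
    using assms(2,3) unfolding has_field_derivative_def by (rule has_derivative_Pair)
  moreover have "(q has_derivative
      (\<lambda>h. fst h * qx (a s, b s) + snd h * qt (a s, b s))) (at (a s, b s))"
    using assms(1) unfolding has_gradient_def by blast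
  ultimately have "((\<lambda>s. q (a s, b s)) has_derivative
      (\<lambda>h. fst (a' * h, b' * h) * qx (a s, b s) + snd (a' * h, b' * h) * qt (a s, b s))) (at s)"
    by (rule has_derivative_compose)
  then show ?thesis
    unfolding has_field_derivative_def
    by (rule has_derivative_eq_rhs) (auto simp: fun_eq_iff algebra_simps)
qed

lemma has_gradient_continuous_on:
  assumes "has_gradient q qx qt"
  shows "continuous_on S q" "continuous_on S qx" "continuous_on S qt"
proof -
  have "q differentiable_on UNIV"
    using assms unfolding has_gradient_def differentiable_on_def differentiable_def
    by blast
  then have "continuous_on UNIV q"
    by (rule differentiable_imp_continuous_on)
  then show "continuous_on S q" "continuous_on S qx" "continuous_on S qt"
    using assms unfolding has_gradient_def by (auto intro: continuous_on_subset)
qed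

section \<open>Continuity and differentiation under the integral sign\<close>

lemma cone_integrand_continuous:
  fixes F :: "real \<Rightarrow> real"
  assumes "continuous_on UNIV F" and "continuous_on UNIV q"
  shows "continuous_on S (\<lambda>p. F (c\<^sup>2 * (fst p)\<^sup>2 * (1 - (snd p)\<^sup>2)) * q (c * fst p * snd p, fst p))"
    and "continuous_on T (\<lambda>y. F (c\<^sup>2 * t\<^sup>2 * (1 - y\<^sup>2)) * q (c * t * y, t))"
  by (intro continuous_intros continuous_on_compose2[OF assms(1)]
        continuous_on_compose2[OF assms(2)]; simp)+

lemma cone_integral_continuous:
  fixes F :: "real \<Rightarrow> real"
  assumes "continuous_on UNIV F" and "continuous_on UNIV q"
  shows "continuous_on S (\<lambda>t. cone_integral c F t (\<lambda>x. q (x, t)))"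
  unfolding cone_integral_def
  using integral_continuous_on_param[of S "-1" 1 "\<lambda>t y. F (c\<^sup>2 * t\<^sup>2 * (1 - y\<^sup>2)) * q (c * t * y, t)"]
    cone_integrand_continuous(1)[OF assms]
  by (simp add: case_prod_unfold)

lemma DERIV_integral_Icc:
  fixes f :: "real \<Rightarrow> real \<Rightarrow> real"
  assumes "\<And>t y. ((\<lambda>t. f t y) has_real_derivative f' t y) (at t)"
    and "\<And>t. continuous_on {a..b} (f t)"
    and "continuous_on UNIV (\<lambda>p. f' (fst p) (snd p))"
  shows "((\<lambda>t. integral {a..b} (f t)) has_real_derivative integral {a..b} (f' t)) (at t)"
proof -
  have "((\<lambda>t. integral (cbox a b) (f t)) has_real_derivative integral (cbox a b) (f' t))
      (at t within UNIV)"
    by (rule leibniz_rule_field_derivative)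
      (use assms in \<open>auto simp: case_prod_unfold intro: integrable_continuous_interval
         continuous_on_subset\<close>)
  then show ?thesis by simp
qed

text \<open>These are the facts about the kernel that the calculus on the cone uses. The equation
  \<open>ode\<close> is Bessel's equation in the variable \<open>w\<close>, where
  \<open>z = 2 a \<surd>w\<close>. The kernel argument vanishes at \<open>y = 1\<close> and
  \<open>y = -1\<close>, so \<open>F_0\<close> gives the boundary values weight one.\<close>

locale cone_kernel =
  fixes a :: real and F G H :: "real \<Rightarrow> real"
  assumes DERIV_F: "\<And>w. (F has_real_derivative G w) (at w)"
    and DERIV_G: "\<And>w. (G has_real_derivative H w) (at w)"
    and ode: "\<And>w. w * H w + G w = a\<^sup>2 * F w"
    and F_0: "F 0 = 1"
begin

lemma continuous_F: "continuous_on S F"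
  using DERIV_F by (intro continuous_at_imp_continuous_on ballI DERIV_isCont)

lemma continuous_G: "continuous_on S G"
  using DERIV_G by (intro continuous_at_imp_continuous_on ballI DERIV_isCont)

text \<open>Differentiation under the integral produces \<open>qx\<close> with the factor
  \<open>c t y\<close>. It is removed by integrating by parts in \<open>y\<close>, which produces
  the boundary values and turns the weight \<open>1 - y\<^sup>2\<close> of \<open>G\<close> into
  \<open>1\<close>. For \<open>q\<close> independent of \<open>t\<close>, half of the result is the
  pairing with \<open>\<psi>\<^sub>t\<close>.\<close>

lemma DERIV_cone_integral:
  assumes q: "has_gradient q qx qt"
  shows "((\<lambda>t. t * cone_integral c F t (\<lambda>x. q (x, t))) has_real_derivative
            q (c * t, t) + q (- c * t, t) + 2 * c\<^sup>2 * t\<^sup>2 * cone_integral c G t (\<lambda>x. q (x, t))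
            + t * cone_integral c F t (\<lambda>x. qt (x, t))) (at t)"
proof -
  note cont = has_gradient_continuous_on[OF q]
  define w :: "real \<Rightarrow> real \<Rightarrow> real" where "w t y = c\<^sup>2 * t\<^sup>2 * (1 - y\<^sup>2)" for t y
  define f where "f = (\<lambda>t y. t * (F (w t y) * q (c * t * y, t)))"
  define f' where "f' t y = F (w t y) * q (c * t * y, t)
      + t * (2 * c\<^sup>2 * t * (1 - y\<^sup>2) * G (w t y) * q (c * t * y, t)
             + F (w t y) * (c * y * qx (c * t * y, t) + qt (c * t * y, t)))" for t y
  have "((\<lambda>t. integral {-1..1} (f t)) has_real_derivative integral {-1..1} (f' t)) (at t)"
  proof (rule DERIV_integral_Icc)
    show "((\<lambda>t. f t y) has_real_derivative f' t y) (at t)" for t y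
      unfolding f_def f'_def w_def
      by (rule derivative_eq_intros DERIV_chain2[OF DERIV_F]
          has_gradient_DERIV_curve[OF q] refl)+ (simp add: algebra_simps power2_eq_square)
    show "continuous_on {-1..1} (f t)" for t
      unfolding f_def w_def
      by (intro continuous_intros cone_integrand_continuous(2) continuous_F cont)
    show "continuous_on UNIV (\<lambda>p. f' (fst p) (snd p))"
      unfolding f'_def w_def
      by (intro continuous_intros continuous_on_compose2[OF continuous_F[of UNIV]]
          continuous_on_compose2[OF continuous_G[of UNIV]]
          continuous_on_compose2[OF cont(1)[of UNIV]]
          continuous_on_compose2[OF cont(2)[of UNIV]]
          continuous_on_compose2[OF cont(3)[of UNIV]]; simp)
  qed
  moreover have "integral {-1..1} (f t) = t * cone_integral c F t (\<lambda>x. q (x, t))" for t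
    by (simp add: f_def w_def cone_integral_def)
  moreover have "integral {-1..1} (f' t) =
      q (c * t, t) + q (- c * t, t) + 2 * c\<^sup>2 * t\<^sup>2 * cone_integral c G t (\<lambda>x. q (x, t))
            + t * cone_integral c F t (\<lambda>x. qt (x, t))"
  proof (rule integral_unique)
    \<comment> \<open>The factor \<open>y\<close> makes \<open>g'\<close> contain exactly the
      \<open>qx\<close> term of \<open>f'\<close>, and makes the two endpoint values add instead of
      subtract.\<close>
    define g where "g y = y * (F (w t y) * q (c * t * y, t))" for y
    define g' where "g' y = F (w t y) * q (c * t * y, t)
      + y * (- 2 * c\<^sup>2 * t\<^sup>2 * y * G (w t y) * q (c * t * y, t)
             + F (w t y) * (c * t * qx (c * t * y, t)))" for y
    have "(g' has_integral g 1 - g (-1)) {-1..1}"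
    proof (rule fundamental_theorem_of_calculus)
      fix y :: real
      have "(g has_real_derivative g' y) (at y)"
        unfolding g_def g'_def w_def
        by (rule derivative_eq_intros DERIV_chain2[OF DERIV_F]
          has_gradient_DERIV_curve[OF q] refl)+ (simp add: algebra_simps power2_eq_square)
      then show "(g has_vector_derivative g' y) (at y within {-1..1})"
        by (simp add: has_real_derivative_iff_has_vector_derivative has_vector_derivative_at_within)
    qed simp
    moreover have "((\<lambda>y. G (w t y) * q (c * t * y, t)) has_integral
        cone_integral c G t (\<lambda>x. q (x, t))) {-1..1}"
      unfolding cone_integral_def w_def
      by (intro integrable_integral integrable_continuous_interval
          cone_integrand_continuous(2) continuous_G cont)
    moreover have "((\<lambda>y. F (w t y) * qt (c * t * y, t)) has_integral
        cone_integral c F t (\<lambda>x. qt (x, t))) {-1..1}"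
      unfolding cone_integral_def w_def
      by (intro integrable_integral integrable_continuous_interval
          cone_integrand_continuous(2) continuous_F cont)
    ultimately have "((\<lambda>y. g' y + 2 * c\<^sup>2 * t\<^sup>2 * (G (w t y) * q (c * t * y, t))
        + t * (F (w t y) * qt (c * t * y, t))) has_integral
        g 1 - g (-1) + 2 * c\<^sup>2 * t\<^sup>2 * cone_integral c G t (\<lambda>x. q (x, t))
            + t * cone_integral c F t (\<lambda>x. qt (x, t))) {-1..1}"
      by (intro has_integral_add has_integral_mult_right)
    moreover have "g 1 - g (-1) = q (c * t, t) + q (- c * t, t)"
      by (simp add: g_def w_def F_0)
    moreover have "(\<lambda>y. g' y + 2 * c\<^sup>2 * t\<^sup>2 * (G (w t y) * q (c * t * y, t))
        + t * (F (w t y) * qt (c * t * y, t))) = f' t"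
      by (rule ext) (simp add: g'_def f'_def algebra_simps power2_eq_square)
    ultimately show "(f' t has_integral
        q (c * t, t) + q (- c * t, t) + 2 * c\<^sup>2 * t\<^sup>2 * cone_integral c G t (\<lambda>x. q (x, t))
            + t * cone_integral c F t (\<lambda>x. qt (x, t))) {-1..1}"
      by simp
  qed
  ultimately show ?thesis by simp
qed

text \<open>This is the second time derivative: the differentiated expression is the pairing of
  \<open>\<psi>\<^sub>t\<close> with \<open>q\<close>. The differential equation brings the
  derivative of \<open>G\<close> back to \<open>F\<close>, and an integration by parts in
  \<open>y\<close> trades \<open>G * qx\<close> for \<open>F * qxx\<close>.\<close>

lemma DERIV_cone_integral_deriv:
  assumes c: "c \<noteq> 0" and q: "has_gradient q qx qt" and qx: "has_gradient qx qxx qxt"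
  shows "((\<lambda>t. (q (c * t, t) + q (- c * t, t)) / 2 + c\<^sup>2 * t\<^sup>2 * cone_integral c G t (\<lambda>x. q (x, t)))
          has_real_derivative
            (qt (c * t, t) + qt (- c * t, t)) / 2 + c\<^sup>2 * t\<^sup>2 * cone_integral c G t (\<lambda>x. qt (x, t))
            + t / 2 * (c\<^sup>2 * cone_integral c F t (\<lambda>x. qxx (x, t))
                       + 4 * a\<^sup>2 * c\<^sup>2 * cone_integral c F t (\<lambda>x. q (x, t)))) (at t)"
proof -
  note cont = has_gradient_continuous_on[OF q] has_gradient_continuous_on[OF qx]
  define w :: "real \<Rightarrow> real \<Rightarrow> real" where "w t y = c\<^sup>2 * t\<^sup>2 * (1 - y\<^sup>2)" for t y
  define f where "f = (\<lambda>t y. t\<^sup>2 * (G (w t y) * q (c * t * y, t)))"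
  define f' where "f' t y = 2 * t * a\<^sup>2 * F (w t y) * q (c * t * y, t)
      + t\<^sup>2 * G (w t y) * (c * y * qx (c * t * y, t) + qt (c * t * y, t))" for t y
  \<comment> \<open>Since \<open>t\<close> times the \<open>t\<close>-derivative of
    \<open>w t y\<close> is \<open>2 * w t y\<close>, the factor \<open>t\<^sup>2\<close> yields
    precisely the combination in \<open>ode\<close>.\<close>
  have DERIV_sq_G: "((\<lambda>t. t\<^sup>2 * G (w t y)) has_real_derivative 2 * t * a\<^sup>2 * F (w t y)) (at t)"
    for t y
  proof -
    have "((\<lambda>t. t\<^sup>2 * G (w t y)) has_real_derivative
        2 * t * (w t y * H (w t y) + G (w t y))) (at t)"
      unfolding w_def
      by (rule derivative_eq_intros DERIV_chain2[OF DERIV_G] refl)+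
        (simp add: algebra_simps power2_eq_square)
    then show ?thesis by (simp add: ode mult.assoc)
  qed
  have "((\<lambda>t. integral {-1..1} (f t)) has_real_derivative integral {-1..1} (f' t)) (at t)"
  proof (rule DERIV_integral_Icc)
    show "((\<lambda>t. f t y) has_real_derivative f' t y) (at t)" for t y
      unfolding f_def f'_def mult.assoc[symmetric]
      by (rule derivative_eq_intros DERIV_sq_G
          has_gradient_DERIV_curve[OF q] refl)+ (simp add: algebra_simps)
    show "continuous_on {-1..1} (f t)" for t
      unfolding f_def w_def
      by (intro continuous_intros cone_integrand_continuous(2) continuous_G cont)
    show "continuous_on UNIV (\<lambda>p. f' (fst p) (snd p))"
      unfolding f'_def w_def
      by (intro continuous_intros continuous_on_compose2[OF continuous_F[of UNIV]]
          continuous_on_compose2[OF continuous_G[of UNIV]]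
          continuous_on_compose2[OF cont(1)[of UNIV]]
          continuous_on_compose2[OF cont(2)[of UNIV]]
          continuous_on_compose2[OF cont(3)[of UNIV]]; simp)
  qed
  moreover have "integral {-1..1} (f t) = t\<^sup>2 * cone_integral c G t (\<lambda>x. q (x, t))" for t
    by (simp add: f_def w_def cone_integral_def)
  moreover have "integral {-1..1} (f' t) =
      2 * t * a\<^sup>2 * cone_integral c F t (\<lambda>x. q (x, t))
      + t / 2 * cone_integral c F t (\<lambda>x. qxx (x, t))
      + t\<^sup>2 * cone_integral c G t (\<lambda>x. qt (x, t))
      - 1 / (2 * c) * (qx (c * t, t) - qx (- c * t, t))"
  proof (rule integral_unique)
    \<comment> \<open>The \<open>y\<close>-derivative of \<open>F (w t y)\<close> carries the factor
      \<open>y * G (w t y)\<close>, so \<open>- 1 / (2 * c) * g'\<close> contains the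
      \<open>qx\<close> term of \<open>f'\<close>. Its \<open>qxx\<close> term is cancelled by the
      one added below. Nothing is divided by \<open>t\<close>, so \<open>t = 0\<close> is
      included.\<close>
    define g where "g y = F (w t y) * qx (c * t * y, t)" for y
    define g' where "g' y = - 2 * c\<^sup>2 * t\<^sup>2 * y * G (w t y) * qx (c * t * y, t)
             + F (w t y) * (c * t * qxx (c * t * y, t))" for y
    have "(g' has_integral g 1 - g (-1)) {-1..1}"
    proof (rule fundamental_theorem_of_calculus)
      fix y :: real
      have "(g has_real_derivative g' y) (at y)"
        unfolding g_def g'_def w_def
        by (rule derivative_eq_intros DERIV_chain2[OF DERIV_F]
          has_gradient_DERIV_curve[OF qx] refl)+ (simp add: algebra_simps power2_eq_square)
      then show "(g has_vector_derivative g' y) (at y within {-1..1})"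
        by (simp add: has_real_derivative_iff_has_vector_derivative has_vector_derivative_at_within)
    qed simp
    moreover have "((\<lambda>y. G (w t y) * qt (c * t * y, t)) has_integral
        cone_integral c G t (\<lambda>x. qt (x, t))) {-1..1}"
      unfolding cone_integral_def w_def
      by (intro integrable_integral integrable_continuous_interval
          cone_integrand_continuous(2) continuous_G cont)
    moreover have "((\<lambda>y. F (w t y) * r (c * t * y, t)) has_integral
        cone_integral c F t (\<lambda>x. r (x, t))) {-1..1}" if "continuous_on UNIV r" for r
      unfolding cone_integral_def w_def
      by (intro integrable_integral integrable_continuous_interval
          cone_integrand_continuous(2) continuous_F that)
    ultimately have "((\<lambda>y. 2 * t * a\<^sup>2 * (F (w t y) * q (c * t * y, t))
        + t / 2 * (F (w t y) * qxx (c * t * y, t))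
        + t\<^sup>2 * (G (w t y) * qt (c * t * y, t)) - 1 / (2 * c) * g' y) has_integral
      2 * t * a\<^sup>2 * cone_integral c F t (\<lambda>x. q (x, t))
      + t / 2 * cone_integral c F t (\<lambda>x. qxx (x, t))
      + t\<^sup>2 * cone_integral c G t (\<lambda>x. qt (x, t))
      - 1 / (2 * c) * (g 1 - g (-1))) {-1..1}"
      by (intro has_integral_add has_integral_diff has_integral_mult_right) (use cont in auto)
    moreover have "g 1 - g (-1) = qx (c * t, t) - qx (- c * t, t)"
      by (simp add: g_def w_def F_0)
    moreover have "(\<lambda>y. 2 * t * a\<^sup>2 * (F (w t y) * q (c * t * y, t))
        + t / 2 * (F (w t y) * qxx (c * t * y, t))
        + t\<^sup>2 * (G (w t y) * qt (c * t * y, t)) - 1 / (2 * c) * g' y) = f' t"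
      using c by (intro ext) (simp add: g'_def f'_def field_simps power2_eq_square)
    ultimately show "(f' t has_integral 2 * t * a\<^sup>2 * cone_integral c F t (\<lambda>x. q (x, t))
      + t / 2 * cone_integral c F t (\<lambda>x. qxx (x, t))
      + t\<^sup>2 * cone_integral c G t (\<lambda>x. qt (x, t))
      - 1 / (2 * c) * (qx (c * t, t) - qx (- c * t, t))) {-1..1}"
      by simp
  qed
  ultimately have D: "((\<lambda>t. t\<^sup>2 * cone_integral c G t (\<lambda>x. q (x, t))) has_real_derivative
      2 * t * a\<^sup>2 * cone_integral c F t (\<lambda>x. q (x, t))
      + t / 2 * cone_integral c F t (\<lambda>x. qxx (x, t))
      + t\<^sup>2 * cone_integral c G t (\<lambda>x. qt (x, t))
      - 1 / (2 * c) * (qx (c * t, t) - qx (- c * t, t))) (at t)"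
    by simp
  \<comment> \<open>Moving the two point masses along the cone produces \<open>qx\<close> at its
    edges; after multiplication of \<open>D\<close> by \<open>c\<^sup>2\<close> these terms cancel
    the boundary terms there.\<close>
  have "((\<lambda>t. (q (c * t, t) + q (- c * t, t)) / 2) has_real_derivative
      ((c * qx (c * t, t) + 1 * qt (c * t, t)) + (- c * qx (- c * t, t) + 1 * qt (- c * t, t))) / 2)
      (at t)"
    by (intro DERIV_cdivide DERIV_add has_gradient_DERIV_curve[OF q] DERIV_cmult_Id DERIV_ident)
  from DERIV_add[OF this DERIV_cmult[OF D, of "c\<^sup>2"]]
  have "((\<lambda>t. (q (c * t, t) + q (- c * t, t)) / 2 + c\<^sup>2 * t\<^sup>2 * cone_integral c G t (\<lambda>x. q (x, t)))
      has_real_derivative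
        ((c * qx (c * t, t) + 1 * qt (c * t, t)) + (- c * qx (- c * t, t) + 1 * qt (- c * t, t))) / 2
        + c\<^sup>2 * (2 * t * a\<^sup>2 * cone_integral c F t (\<lambda>x. q (x, t))
          + t / 2 * cone_integral c F t (\<lambda>x. qxx (x, t))
          + t\<^sup>2 * cone_integral c G t (\<lambda>x. qt (x, t))
          - 1 / (2 * c) * (qx (c * t, t) - qx (- c * t, t)))) (at t)"
    by (simp only: mult.assoc)
  then show ?thesis
    by (rule DERIV_cong) (use c in \<open>simp add: field_simps power2_eq_square\<close>)
qed

end

section \<open>Smooth functions and test functions\<close>

definition dirderiv :: "'a::euclidean_space \<Rightarrow> ('a \<Rightarrow> real) \<Rightarrow> 'a \<Rightarrow> real" where
  "dirderiv v f x = frechet_derivative f (at x) v"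

definition smooth :: "('a::euclidean_space \<Rightarrow> real) \<Rightarrow> bool" where
  "smooth f \<longleftrightarrow> (\<forall>n. C_diff n f)"

lemma smooth_dirderiv: "smooth f \<Longrightarrow> smooth (dirderiv v f)"
  unfolding smooth_def dirderiv_def by (metis C_diff.simps(2))

lemma smooth_continuous_on: "smooth f \<Longrightarrow> continuous_on S f"
  unfolding smooth_def by (metis C_diff.simps(1) continuous_on_subset subset_UNIV)

lemma smooth_has_derivative:
  assumes "smooth f"
  shows "(f has_derivative (\<lambda>v. dirderiv v f x)) (at x)"
proof -
  have "C_diff (Suc 0) f" using assms unfolding smooth_def by blast
  then have "f differentiable (at x)" by (simp add: differentiable_on_def)
  then show ?thesis unfolding frechet_derivative_works dirderiv_def .
qed

lemma smooth_has_gradient: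
  fixes f :: "real \<times> real \<Rightarrow> real"
  assumes "smooth f"
  shows "has_gradient f (dirderiv (1, 0) f) (dirderiv (0, 1) f)"
  unfolding has_gradient_def
proof (intro conjI allI smooth_continuous_on smooth_dirderiv assms)
  fix z :: "real \<times> real"
  have lin: "linear (\<lambda>v. dirderiv v f z)"
    using smooth_has_derivative[OF assms] by (rule has_derivative_linear)
  have "dirderiv h f z = fst h * dirderiv (1, 0) f z + snd h * dirderiv (0, 1) f z" for h
    using linear_add[OF lin, of "fst h *\<^sub>R (1, 0)" "snd h *\<^sub>R (0, 1)"]
      linear_scale[OF lin, of "fst h" "(1, 0)"] linear_scale[OF lin, of "snd h" "(0, 1)"]
    by simp
  then show "(f has_derivative
      (\<lambda>h. fst h * dirderiv (1, 0) f z + snd h * dirderiv (0, 1) f z)) (at z)"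
    by (intro has_derivative_eq_rhs[OF smooth_has_derivative[OF assms, of z]] ext)
qed

text \<open>A test function on the line is read as a function on the plane that is constant in time,
  so that \<open>DERIV_cone_integral\<close> also gives \<open>\<psi>\<^sub>t\<close>.\<close>

lemma smooth_has_gradient_fst:
  assumes "smooth \<phi>"
  shows "has_gradient (\<lambda>z. \<phi> (fst z)) (\<lambda>z. dirderiv 1 \<phi> (fst z)) (\<lambda>_. 0)"
  unfolding has_gradient_def
proof (intro conjI allI continuous_on_const)
  fix z :: "real \<times> real"
  have lin: "linear (\<lambda>v. dirderiv v \<phi> (fst z))"
    using smooth_has_derivative[OF assms] by (rule has_derivative_linear)
  have "((\<lambda>z. \<phi> (fst z)) has_derivative (\<lambda>h. dirderiv (fst h) \<phi> (fst z))) (at z)"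
    by (rule has_derivative_compose[OF has_derivative_fst[OF has_derivative_ident]
        smooth_has_derivative[OF assms]])
  moreover have "dirderiv h \<phi> (fst z) = h * dirderiv 1 \<phi> (fst z)" for h
    using linear_scale[OF lin, of h 1] by simp
  ultimately show "((\<lambda>z. \<phi> (fst z)) has_derivative
      (\<lambda>h. fst h * dirderiv 1 \<phi> (fst z) + snd h * 0)) (at z)"
    unfolding mult_zero_right add_0_right by (elim has_derivative_eq_rhs) (rule ext)
  show "continuous_on UNIV (\<lambda>z::real \<times> real. dirderiv 1 \<phi> (fst z))"
    by (intro continuous_on_compose2[OF smooth_continuous_on[OF smooth_dirderiv[OF assms], of UNIV]]
        continuous_intros) auto
qed

text \<open>Connects the iterated one-variable derivatives in \<open>solves_equation\<close> with
  the partial derivatives used in the cone calculus.\<close>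

lemma second_partials:
  fixes f :: "real \<times> real \<Rightarrow> real"
  assumes "smooth f"
  shows "(deriv ^^ 2) (\<lambda>y. f (y, t)) x = dirderiv (1, 0) (dirderiv (1, 0) f) (x, t)"
    and "(deriv ^^ 2) (\<lambda>s. f (x, s)) t = dirderiv (0, 1) (dirderiv (0, 1) f) (x, t)"
proof -
  have D: "deriv (\<lambda>y. g (y, t)) = (\<lambda>y. dirderiv (1, 0) g (y, t))"
       "deriv (\<lambda>s. g (x, s)) = (\<lambda>s. dirderiv (0, 1) g (x, s))" if "smooth g" for g
    using has_gradient_DERIV_curve[OF smooth_has_gradient[OF that], of "\<lambda>y. y" 1 _ "\<lambda>_. t" 0]
      has_gradient_DERIV_curve[OF smooth_has_gradient[OF that], of "\<lambda>_. x" 0 _ "\<lambda>s. s" 1]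
    by (auto intro!: ext DERIV_imp_deriv)
  then show "(deriv ^^ 2) (\<lambda>y. f (y, t)) x = dirderiv (1, 0) (dirderiv (1, 0) f) (x, t)"
    and "(deriv ^^ 2) (\<lambda>s. f (x, s)) t = dirderiv (0, 1) (dirderiv (0, 1) f) (x, t)"
    using D[OF assms] D[OF smooth_dirderiv[OF assms, of "(1, 0)"]]
      D[OF smooth_dirderiv[OF assms, of "(0, 1)"]]
    by (simp_all add: numeral_2_eq_2)
qed

lemma dirderiv_eq_0:
  assumes "open U" and "\<And>x. x \<in> U \<Longrightarrow> f x = 0" and "x \<in> U"
  shows "dirderiv v f x = 0"
proof -
  have "(f has_derivative (\<lambda>_. 0)) (at x)"
    by (rule has_derivative_transform_within_open[OF has_derivative_const assms(1,3)])
      (simp add: assms(2))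
  then show ?thesis
    unfolding dirderiv_def by (simp add: frechet_derivative_at[symmetric])
qed

lemma test_function_smooth: "\<phi> \<in> test_functions \<Longrightarrow> smooth \<phi>"
  by (simp add: test_functions_def smooth_def)

lemma test_function_bounded_support:
  assumes "\<phi> \<in> test_functions"
  obtains R where "R > 0" and "\<And>x. norm x > R \<Longrightarrow> \<phi> x = 0"
proof -
  have "bounded (closure {x. \<phi> x \<noteq> 0})"
    using assms by (simp add: test_functions_def compact_imp_bounded)
  then obtain R where "R > 0" "\<And>x. x \<in> closure {x. \<phi> x \<noteq> 0} \<Longrightarrow> norm x \<le> R"
    by (meson bounded_pos)
  then show ?thesis
    using that[of R] closure_subset[of "{x. \<phi> x \<noteq> 0}"] by fastforce
qed

section \<open>Distributions on the line\<close>

lemma distribution_dirac: "distribution (dirac p)"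
  unfolding distribution_def dirac_def test_converges_def
proof (intro conjI ballI allI impI refl)
  fix \<Phi> :: "nat \<Rightarrow> real \<Rightarrow> real" and \<phi>
  assume "(\<forall>n. \<Phi> n \<in> test_functions) \<and> \<phi> \<in> test_functions \<and>
    (\<exists>K. compact K \<and> (\<forall>n. {x. \<Phi> n x \<noteq> 0} \<subseteq> K)) \<and>
    (\<forall>j. uniform_limit UNIV (\<lambda>n. (deriv ^^ j) (\<Phi> n)) ((deriv ^^ j) \<phi>) sequentially)"
  \<comment> \<open>This is the case \<open>j = 0\<close> of the convergence of derivatives.\<close>
  then have "uniform_limit UNIV \<Phi> \<phi> sequentially"
    by (metis (no_types, lifting) ext funpow_0)
  then show "(\<lambda>n. \<Phi> n p) \<longlonglongrightarrow> \<phi> p"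
    by (rule tendsto_uniform_limitI) simp
qed

lemma distribution_lincomb:
  assumes S: "distribution S" and T: "distribution T"
  shows "distribution (\<lambda>\<phi>. a * S \<phi> + b * T \<phi>)"
  unfolding distribution_def
proof (intro conjI ballI allI impI)
  fix \<phi> \<theta> :: "real \<Rightarrow> real" and p q :: real
  assume "\<phi> \<in> test_functions" "\<theta> \<in> test_functions"
  then show "a * S (\<lambda>x. p * \<phi> x + q * \<theta> x) + b * T (\<lambda>x. p * \<phi> x + q * \<theta> x) =
      p * (a * S \<phi> + b * T \<phi>) + q * (a * S \<theta> + b * T \<theta>)"
    using S T unfolding distribution_def by (simp add: algebra_simps)
next
  fix \<Phi> :: "nat \<Rightarrow> real \<Rightarrow> real" and \<phi>
  assume "(\<forall>n. \<Phi> n \<in> test_functions) \<and> \<phi> \<in> test_functions \<and> test_converges \<Phi> \<phi>"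
  then show "(\<lambda>n. a * S (\<Phi> n) + b * T (\<Phi> n)) \<longlonglongrightarrow> a * S \<phi> + b * T \<phi>"
    using S T unfolding distribution_def by (intro tendsto_intros) auto
qed

text \<open>
  Functionals are compared on all continuous functions because \<open>distribution\<close> also
  evaluates its argument at linear combinations of test functions.
\<close>

lemma distribution_cong:
  assumes "distribution T"
    and eq: "\<And>\<phi>. continuous_on UNIV \<phi> \<Longrightarrow> S \<phi> = T \<phi>"
  shows "distribution S"
proof -
  have cont: "continuous_on UNIV \<phi>" if "\<phi> \<in> test_functions" for \<phi> :: "real \<Rightarrow> real"
    using that test_function_smooth smooth_continuous_on by blast
  have "S (\<lambda>x. a * \<phi> x + b * \<theta> x) = T (\<lambda>x. a * \<phi> x + b * \<theta> x)"
    if "\<phi> \<in> test_functions" "\<theta> \<in> test_functions" for \<phi> \<theta> a b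
    by (intro eq continuous_intros cont that)
  then show ?thesis
    using assms(1) unfolding distribution_def by (auto simp: eq cont)
qed

text \<open>The functional has order zero: uniform convergence of the test functions passes through
  the product with the bounded kernel and through the integral over the fixed interval.\<close>

lemma distribution_cone_integral:
  assumes F: "continuous_on UNIV F"
  shows "distribution (cone_integral c F t)"
  unfolding distribution_def
proof (intro conjI ballI allI impI)
  have cont: "continuous_on {-1..1} (\<lambda>y. F (c\<^sup>2 * t\<^sup>2 * (1 - y\<^sup>2)) * \<phi> (c * t * y))"
    if "\<phi> \<in> test_functions" for \<phi> :: "real \<Rightarrow> real"
    by (intro continuous_intros continuous_on_compose2[OF F]
        continuous_on_compose2[OF smooth_continuous_on[OF test_function_smooth[OF that], of UNIV]])
      simp_all
  {
    fix \<phi> \<theta> :: "real \<Rightarrow> real" and p q :: real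
    assume "\<phi> \<in> test_functions" "\<theta> \<in> test_functions"
    note int = integrable_integral[OF integrable_continuous_interval[OF cont[OF this(1)]]]
      integrable_integral[OF integrable_continuous_interval[OF cont[OF this(2)]]]
    show "cone_integral c F t (\<lambda>x. p * \<phi> x + q * \<theta> x) =
        p * cone_integral c F t \<phi> + q * cone_integral c F t \<theta>"
      unfolding cone_integral_def
      using has_integral_add[OF has_integral_mult_right[OF int(1), of p]
          has_integral_mult_right[OF int(2), of q]]
      by (intro integral_unique) (simp add: algebra_simps)
  next
    fix \<Phi> :: "nat \<Rightarrow> real \<Rightarrow> real" and \<phi>
    assume conv: "(\<forall>n. \<Phi> n \<in> test_functions) \<and> \<phi> \<in> test_functions \<and> test_converges \<Phi> \<phi>"
    then have "uniform_limit UNIV \<Phi> \<phi> sequentially"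
      unfolding test_converges_def by (metis (no_types, lifting) ext funpow_0)
    then have "uniform_limit {-1..1} (\<lambda>n y. \<Phi> n (c * t * y)) (\<lambda>y. \<phi> (c * t * y)) sequentially"
      by (rule uniform_limit_compose') auto
    moreover have "continuous_on {-1..1} (\<lambda>y. F (c\<^sup>2 * t\<^sup>2 * (1 - y\<^sup>2)))"
      by (intro continuous_intros continuous_on_compose2[OF F]) simp
    then have "bounded ((\<lambda>y. F (c\<^sup>2 * t\<^sup>2 * (1 - y\<^sup>2))) ` {-1..1})"
      by (intro compact_imp_bounded compact_continuous_image) simp_all
    moreover have "continuous_on {-1..1} (\<lambda>y. \<phi> (c * t * y))"
      using conv
      by (intro continuous_on_compose2[OF smooth_continuous_on[OF test_function_smooth, of \<phi> UNIV]]
          continuous_intros) auto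
    then have "bounded ((\<lambda>y. \<phi> (c * t * y)) ` {-1..1})"
      by (intro compact_imp_bounded compact_continuous_image) simp_all
    ultimately have "uniform_limit {-1..1}
        (\<lambda>n y. F (c\<^sup>2 * t\<^sup>2 * (1 - y\<^sup>2)) * \<Phi> n (c * t * y))
        (\<lambda>y. F (c\<^sup>2 * t\<^sup>2 * (1 - y\<^sup>2)) * \<phi> (c * t * y)) sequentially"
      by (intro uniform_lim_mult uniform_limit_const)
    then obtain I J where lim:
      "\<And>n. ((\<lambda>y. F (c\<^sup>2 * t\<^sup>2 * (1 - y\<^sup>2)) * \<Phi> n (c * t * y)) has_integral I n) {-1..1}"
      "((\<lambda>y. F (c\<^sup>2 * t\<^sup>2 * (1 - y\<^sup>2)) * \<phi> (c * t * y)) has_integral J) {-1..1}"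
      "I \<longlonglongrightarrow> J"
      using conv by (elim uniform_limit_integral) (auto intro: cont)
    show "(\<lambda>n. cone_integral c F t (\<Phi> n)) \<longlonglongrightarrow> cone_integral c F t \<phi>"
      unfolding cone_integral_def integral_unique[OF lim(1)] integral_unique[OF lim(2)]
      by (rule lim(3))
  }
qed

text \<open>The substitution \<open>x = c t y\<close>. The function \<open>g\<close> is prescribed
  only inside the cone, because the indicator removes its values elsewhere.\<close>

lemma regular_distr_eq_cone_integral:
  assumes F: "continuous_on UNIV F" and \<phi>: "continuous_on UNIV \<phi>" and "c > 0"
    and g: "\<And>x. \<bar>x\<bar> \<le> c * \<bar>t\<bar> \<Longrightarrow> g x = F (c\<^sup>2 * t\<^sup>2 - x\<^sup>2)"
  shows "regular_distr (\<lambda>x. g x * indicator {- c * \<bar>t\<bar>..c * \<bar>t\<bar>} x) \<phi>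
           = c * \<bar>t\<bar> * cone_integral c F t \<phi>"
proof -
  define f where "f x = F (c\<^sup>2 * t\<^sup>2 - x\<^sup>2) * \<phi> x" for x
  define r where "r = c * \<bar>t\<bar>"
  have cont: "continuous_on S f" for S
    unfolding f_def
    by (intro continuous_intros continuous_on_compose2[OF F] continuous_on_subset[OF \<phi>]) simp_all
  have "regular_distr (\<lambda>x. g x * indicator {- c * \<bar>t\<bar>..c * \<bar>t\<bar>} x) \<phi>
      = (LINT x : {-r..r} | lborel. f x)"
    unfolding regular_distr_def set_lebesgue_integral_def r_def
    by (intro Bochner_Integration.integral_cong refl) (auto simp: g f_def indicator_def abs_le_iff)
  also have "\<dots> = integral {-r..r} f"
    using cont by (intro set_borel_integral_eq_integral borel_integrable_atLeastAtMost')
  also have "\<dots> = r * cone_integral c F t \<phi>"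
  proof (cases "t = 0")
    case True
    then show ?thesis by (simp add: r_def)
  next
    case False
    then have ct: "c * t \<noteq> 0" and r: "r = \<bar>c * t\<bar>" "r > 0"
      using \<open>c > 0\<close> by (auto simp: r_def abs_mult)
    \<comment> \<open>For negative \<open>t\<close> the scaling reverses the interval, which is
      symmetric, so both signs give the same image; the Jacobian is the absolute value
      \<open>r\<close>.\<close>
    have img: "(\<lambda>x. x / (c * t)) ` {-r..r} = {-1..1}"
    proof (intro equalityI subsetI)
      fix y assume "y \<in> (\<lambda>x. x / (c * t)) ` {-r..r}"
      then obtain x where x: "y = x / (c * t)" "x \<in> {-r..r}" by blast
      then have "\<bar>x\<bar> \<le> \<bar>c * t\<bar>" using r(1) by auto
      then have "\<bar>y\<bar> \<le> 1" using ct x(1) by (simp add: abs_divide divide_le_eq)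
      then show "y \<in> {-1..1}" by auto
    next
      fix y :: real assume "y \<in> {-1..1}"
      then have "\<bar>y\<bar> \<le> 1" by auto
      then have "\<bar>c * t * y\<bar> \<le> r" using r by (simp add: abs_mult mult_left_le)
      then have "c * t * y \<in> {-r..r}" by auto
      then show "y \<in> (\<lambda>x. x / (c * t)) ` {-r..r}"
        using ct by (intro image_eqI[of _ _ "c * t * y"]) auto
    qed
    have "(f has_integral integral {-r..r} f) {-r..r}"
      using cont by (intro integrable_integral integrable_continuous_interval)
    from has_integral_stretch_real[OF this ct]
    have "((\<lambda>y. f (c * t * y)) has_integral 1 / r * integral {-r..r} f) {-1..1}"
      unfolding img by (simp add: r(1))
    moreover have "(\<lambda>y. f (c * t * y)) = (\<lambda>y. F (c\<^sup>2 * t\<^sup>2 * (1 - y\<^sup>2)) * \<phi> (c * t * y))"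
      by (simp add: f_def fun_eq_iff algebra_simps power_mult_distrib)
    ultimately have "cone_integral c F t \<phi> = 1 / r * integral {-r..r} f"
      unfolding cone_integral_def by (simp add: integral_unique)
    then show ?thesis using r by simp
  qed
  finally show ?thesis by (simp add: r_def)
qed

section \<open>The Bessel kernel as an entire function\<close>

text \<open>The series of \<open>I\<^sub>0 (2 a s)\<close> has only even powers of \<open>s\<close>;
  these are its coefficients as a power series in \<open>w = s\<^sup>2\<close>, which makes sense
  for negative \<open>w\<close> too.\<close>

definition bessel_coeff :: "real \<Rightarrow> nat \<Rightarrow> real" where
  "bessel_coeff a n = (a\<^sup>2) ^ n / (fact n)\<^sup>2"

definition bessel_kernel :: "real \<Rightarrow> real \<Rightarrow> real" where
  "bessel_kernel a w = (\<Sum>n. bessel_coeff a n * w ^ n)"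

definition bessel_kernel' :: "real \<Rightarrow> real \<Rightarrow> real" where
  "bessel_kernel' a w = (\<Sum>n. diffs (bessel_coeff a) n * w ^ n)"

definition bessel_kernel'' :: "real \<Rightarrow> real \<Rightarrow> real" where
  "bessel_kernel'' a w = (\<Sum>n. diffs (diffs (bessel_coeff a)) n * w ^ n)"

lemma summable_bessel_coeff: "summable (\<lambda>n. bessel_coeff a n * w ^ n)"
proof (rule summable_comparison_test')
  show "summable (\<lambda>n. \<bar>a\<^sup>2 * w\<bar> ^ n / fact n)"
    using summable_exp[of "\<bar>a\<^sup>2 * w\<bar>"] by (simp add: field_simps)
  fix n :: nat
  have "norm (bessel_coeff a n * w ^ n) = \<bar>a\<^sup>2 * w\<bar> ^ n / (fact n)\<^sup>2"
    by (simp add: bessel_coeff_def abs_mult power_abs power_mult_distrib)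
  also have "\<dots> \<le> \<bar>a\<^sup>2 * w\<bar> ^ n / fact n"
    by (intro divide_left_mono) (simp_all add: self_le_power)
  finally show "norm (bessel_coeff a n * w ^ n) \<le> \<bar>a\<^sup>2 * w\<bar> ^ n / fact n" .
qed

text \<open>Termwise differentiation is allowed everywhere, and the differential equation then
  amounts to the recurrence \<open>(n + 1)\<^sup>2 b (n + 1) = a\<^sup>2 b n\<close> for the
  coefficients.\<close>

lemma cone_kernel_bessel:
  "cone_kernel a (bessel_kernel a) (bessel_kernel' a) (bessel_kernel'' a)"
proof
  note S0 = summable_bessel_coeff[of a]
  note S1 = termdiff_converges_all[OF S0]
  note S2 = termdiff_converges_all[OF S1]
  show "(bessel_kernel a has_real_derivative bessel_kernel' a w) (at w)" for w
    using termdiffs_strong_converges_everywhere[OF S0]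
    unfolding bessel_kernel_def[abs_def] bessel_kernel'_def .
  show "(bessel_kernel' a has_real_derivative bessel_kernel'' a w) (at w)" for w
    using termdiffs_strong_converges_everywhere[OF S1]
    unfolding bessel_kernel'_def[abs_def] bessel_kernel''_def .
  show "bessel_kernel a 0 = 1"
    unfolding bessel_kernel_def powser_zero by (simp add: bessel_coeff_def)
  show "w * bessel_kernel'' a w + bessel_kernel' a w = a\<^sup>2 * bessel_kernel a w" for w
  proof -
    let ?d = "\<lambda>n. of_nat n * diffs (bessel_coeff a) n * w ^ n"
    have "(\<lambda>n. diffs (diffs (bessel_coeff a)) n * w ^ n * w) sums (bessel_kernel'' a w * w)"
      unfolding bessel_kernel''_def by (intro sums_mult2 summable_sums S2)
    then have "(\<lambda>n. ?d (Suc n)) sums (bessel_kernel'' a w * w)"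
      by (simp add: diffs_def mult_ac)
    \<comment> \<open>The shift of index costs nothing because \<open>?d 0 = 0\<close>.\<close>
    then have "?d sums (bessel_kernel'' a w * w)"
      using sums_Suc_iff[of ?d] by simp
    moreover have "(\<lambda>n. diffs (bessel_coeff a) n * w ^ n) sums bessel_kernel' a w"
      unfolding bessel_kernel'_def by (intro summable_sums S1)
    ultimately have "(\<lambda>n. ?d n + diffs (bessel_coeff a) n * w ^ n) sums
        (bessel_kernel'' a w * w + bessel_kernel' a w)"
      by (rule sums_add)
    moreover have "?d n + diffs (bessel_coeff a) n * w ^ n = a\<^sup>2 * (bessel_coeff a n * w ^ n)" for n
    proof -
      have "(real (Suc n))\<^sup>2 * bessel_coeff a (Suc n) = a\<^sup>2 * bessel_coeff a n"
        by (simp add: bessel_coeff_def power_mult_distrib del: of_nat_Suc)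
      then have "(real n + 1) * diffs (bessel_coeff a) n = a\<^sup>2 * bessel_coeff a n"
        by (simp add: diffs_def power2_eq_square algebra_simps)
      then have "(real n + 1) * diffs (bessel_coeff a) n * w ^ n = a\<^sup>2 * bessel_coeff a n * w ^ n"
        by simp
      then show ?thesis by (simp only: distrib_right mult_1 mult.assoc)
    qed
    moreover have "(\<lambda>n. a\<^sup>2 * (bessel_coeff a n * w ^ n)) sums (a\<^sup>2 * bessel_kernel a w)"
      unfolding bessel_kernel_def by (intro sums_mult summable_sums S0)
    ultimately show ?thesis
      by (simp add: sums_iff mult.commute)
  qed
qed

lemma bessel_I0_eq_bessel_kernel: "bessel_I0 (2 * a * s) = bessel_kernel a (s\<^sup>2)"
  by (simp add: bessel_I0_def bessel_kernel_def bessel_coeff_def power_mult power_mult_distrib)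

text \<open>For \<open>s \<noteq> 0\<close> this is the chain rule for
  \<open>I\<^sub>0 z = F ((z / (2 a))\<^sup>2)\<close>. At \<open>s = 0\<close> the continued value
  gives \<open>a * a\<close>, the linear coefficient of the kernel.\<close>

lemma bessel_I0'_quotient_eq_bessel_kernel:
  assumes "a > 0"
  shows "a * bessel_I0'_quotient a s = bessel_kernel' a (s\<^sup>2)"
proof (cases "s = 0")
  case True
  then show ?thesis
    using powser_zero[of "diffs (bessel_coeff a)"]
    by (simp add: bessel_I0'_quotient_def bessel_kernel'_def bessel_coeff_def[of a "Suc 0"]
        diffs_def power2_eq_square)
next
  case False
  interpret cone_kernel a "bessel_kernel a" "bessel_kernel' a" "bessel_kernel'' a"
    by (rule cone_kernel_bessel)
  have I0: "bessel_I0 = (\<lambda>z. bessel_kernel a ((1 / (2 * a) * z)\<^sup>2))"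
  proof
    fix z
    show "bessel_I0 z = bessel_kernel a ((1 / (2 * a) * z)\<^sup>2)"
      unfolding bessel_I0_eq_bessel_kernel[symmetric] using assms by simp
  qed
  have "((\<lambda>z. (1 / (2 * a) * z)\<^sup>2) has_real_derivative
      2 * (1 / (2 * a)) * (1 / (2 * a) * (2 * a * s))) (at (2 * a * s))"
    by (rule derivative_eq_intros refl)+ simp
  moreover have s: "1 / (2 * a) * (2 * a * s) = s"
    using assms by simp
  ultimately have "((\<lambda>z. (1 / (2 * a) * z)\<^sup>2) has_real_derivative s / a) (at (2 * a * s))"
    by simp
  from DERIV_chain2[OF DERIV_F this]
  have "(bessel_I0 has_real_derivative bessel_kernel' a (s\<^sup>2) * (s / a)) (at (2 * a * s))"
    unfolding I0 s .
  then have "deriv bessel_I0 (2 * a * s) = bessel_kernel' a (s\<^sup>2) * (s / a)"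
    by (rule DERIV_imp_deriv)
  then show ?thesis using False assms by (simp add: bessel_I0'_quotient_def)
qed

section \<open>The fundamental solution\<close>

theorem theorem1p1:
  fixes k c \<alpha> :: real and \<psi> :: "real \<Rightarrow> real \<Rightarrow> real"
  assumes "k > 0" and "c > 0" and "\<alpha> = k / (4 * c)"
    and "\<And>x t. \<psi> x t = sgn t * (1 / (2 * c)) * bessel_I0 (2 * \<alpha> * sqrt (c\<^sup>2 * t\<^sup>2 - x\<^sup>2))
                        * indicator {- c * \<bar>t\<bar>..c * \<bar>t\<bar>} x"
  shows "C1_distr (\<lambda>t. regular_distr (\<lambda>x. \<psi> x t))
    \<and> solves_ivp k c (\<lambda>t. regular_distr (\<lambda>x. \<psi> x t)) (\<lambda>_. 0) (dirac 0)
    \<and> has_time_derivative (\<lambda>t. regular_distr (\<lambda>x. \<psi> x t))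
        (\<lambda>t \<phi>. 1 / 2 * (dirac (c * t) \<phi> + dirac (- c * t) \<phi>)
           + regular_distr
               (\<lambda>x. \<alpha> * c * \<bar>t\<bar> * bessel_I0'_quotient \<alpha> (sqrt (c\<^sup>2 * t\<^sup>2 - x\<^sup>2))
                      * indicator {- c * \<bar>t\<bar>..c * \<bar>t\<bar>} x) \<phi>)"
proof -

  \<comment> \<open>The pairings as cone integrals\<close>
  define v where "v = (\<lambda>t. regular_distr (\<lambda>x. \<psi> x t))"
  define w where "w = (\<lambda>t \<phi>. 1 / 2 * (dirac (c * t) \<phi> + dirac (- c * t) \<phi>)
     + regular_distr
         (\<lambda>x. \<alpha> * c * \<bar>t\<bar> * bessel_I0'_quotient \<alpha> (sqrt (c\<^sup>2 * t\<^sup>2 - x\<^sup>2))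
                * indicator {- c * \<bar>t\<bar>..c * \<bar>t\<bar>} x) \<phi>)"
  define F where "F = bessel_kernel \<alpha>"
  define G where "G = bessel_kernel' \<alpha>"
  have "\<alpha> > 0" using assms by simp
  interpret cone_kernel \<alpha> F G "bessel_kernel'' \<alpha>"
    unfolding F_def G_def by (rule cone_kernel_bessel)
  \<comment> \<open>The bound on \<open>x\<close> matters: \<open>sqrt\<close> is total, and the
    square of its value at a negative argument is not that argument.\<close>
  have in_cone: "(sqrt (c\<^sup>2 * t\<^sup>2 - x\<^sup>2))\<^sup>2 = c\<^sup>2 * t\<^sup>2 - x\<^sup>2" if "\<bar>x\<bar> \<le> c * \<bar>t\<bar>" for x t
  proof -
    have "x\<^sup>2 \<le> (c * \<bar>t\<bar>)\<^sup>2"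
      using power_mono[OF that abs_ge_zero, of 2] by simp
    then show ?thesis by (simp add: power_mult_distrib)
  qed
  have v_eq: "v t \<phi> = t / 2 * cone_integral c F t \<phi>" if "continuous_on UNIV \<phi>" for t \<phi>
  proof -
    have "v t \<phi> = regular_distr (\<lambda>x. sgn t * (1 / (2 * c)) *
        bessel_I0 (2 * \<alpha> * sqrt (c\<^sup>2 * t\<^sup>2 - x\<^sup>2)) * indicator {- c * \<bar>t\<bar>..c * \<bar>t\<bar>} x) \<phi>"
      unfolding v_def assms(4) ..
    also have "\<dots> = c * \<bar>t\<bar> * cone_integral c (\<lambda>w. sgn t * (1 / (2 * c)) * F w) t \<phi>"
      using assms(2)
      by (intro regular_distr_eq_cone_integral continuous_intros continuous_F that)
        (simp_all add: in_cone bessel_I0_eq_bessel_kernel F_def)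
    also have "\<dots> = c * \<bar>t\<bar> * (sgn t * (1 / (2 * c)) * cone_integral c F t \<phi>)"
      unfolding cone_integral_def by (simp add: mult.assoc)
    also have "\<dots> = t / 2 * cone_integral c F t \<phi>"
      using assms(2) by (simp add: abs_sgn[of t] sgn_if)
    finally show ?thesis .
  qed
  have w_eq: "w t \<phi> = (\<phi> (c * t) + \<phi> (- c * t)) / 2 + c\<^sup>2 * t\<^sup>2 * cone_integral c G t \<phi>"
    if "continuous_on UNIV \<phi>" for t \<phi>
  proof -
    have "regular_distr
         (\<lambda>x. \<alpha> * c * \<bar>t\<bar> * bessel_I0'_quotient \<alpha> (sqrt (c\<^sup>2 * t\<^sup>2 - x\<^sup>2))
                * indicator {- c * \<bar>t\<bar>..c * \<bar>t\<bar>} x) \<phi>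
        = c * \<bar>t\<bar> * cone_integral c (\<lambda>w. c * \<bar>t\<bar> * G w) t \<phi>"
    proof (intro regular_distr_eq_cone_integral continuous_intros continuous_G that assms(2))
      fix x assume "\<bar>x\<bar> \<le> c * \<bar>t\<bar>"
      then have "\<alpha> * bessel_I0'_quotient \<alpha> (sqrt (c\<^sup>2 * t\<^sup>2 - x\<^sup>2)) = G (c\<^sup>2 * t\<^sup>2 - x\<^sup>2)"
        using bessel_I0'_quotient_eq_bessel_kernel[OF \<open>\<alpha> > 0\<close>] by (simp add: G_def in_cone)
      then show "\<alpha> * c * \<bar>t\<bar> * bessel_I0'_quotient \<alpha> (sqrt (c\<^sup>2 * t\<^sup>2 - x\<^sup>2))
          = c * \<bar>t\<bar> * G (c\<^sup>2 * t\<^sup>2 - x\<^sup>2)"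
        by (simp add: mult_ac)
    qed
    also have "\<dots> = c * \<bar>t\<bar> * (c * \<bar>t\<bar> * cone_integral c G t \<phi>)"
      unfolding cone_integral_def by (simp add: mult.assoc)
    also have "\<dots> = c\<^sup>2 * t\<^sup>2 * cone_integral c G t \<phi>"
      by (simp add: power2_eq_square mult_ac abs_mult_self_eq flip: mult.assoc[of "\<bar>t\<bar>" "\<bar>t\<bar>"])
    finally show ?thesis by (simp add: w_def dirac_def)
  qed

  \<comment> \<open>Continuous differentiability in time\<close>
  have "distribution (v t)" for t
    \<comment> \<open>The Dirac term has coefficient \<open>0\<close>, which turns the linear
      combination into a scalar multiple.\<close>
    using distribution_lincomb[OF distribution_cone_integral[OF continuous_F, of c t]
        distribution_dirac[of 0], of "t / 2" 0]
    by (rule distribution_cong) (simp add: v_eq)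
  moreover have distr_w: "distribution (w t)" for t
    using distribution_lincomb[OF
        distribution_lincomb[OF distribution_dirac[of "c * t"] distribution_dirac[of "- c * t"],
          of "1 / 2" "1 / 2"]
        distribution_cone_integral[OF continuous_G, of c t], of 1 "c\<^sup>2 * t\<^sup>2"]
    by (rule distribution_cong) (simp add: w_eq dirac_def add_divide_distrib)
  moreover have vw: "has_time_derivative v w"
    unfolding has_time_derivative_def
  proof (intro conjI allI ballI distr_w)
    fix \<phi> :: "real \<Rightarrow> real" and t assume "\<phi> \<in> test_functions"
    then have \<phi>: "smooth \<phi>" by (rule test_function_smooth)
    note cont = smooth_continuous_on[OF \<phi>]
    have "cone_integral c F t (\<lambda>x. 0) = 0" by (simp add: cone_integral_def)
    with DERIV_cone_integral[OF smooth_has_gradient_fst[OF \<phi>], of c t]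
    have "((\<lambda>t. t * cone_integral c F t \<phi>) has_real_derivative
        \<phi> (c * t) + \<phi> (- c * t) + 2 * c\<^sup>2 * t\<^sup>2 * cone_integral c G t \<phi>) (at t)"
      by simp
    from DERIV_cdivide[OF this, of 2] have "((\<lambda>t. v t \<phi>) has_real_derivative w t \<phi>) (at t)"
      by (simp add: v_eq w_eq cont field_simps)
    then show "((\<lambda>h. (v (t + h) \<phi> - v t \<phi>) / h) \<longlongrightarrow> w t \<phi>) (at 0)"
      by (simp add: DERIV_def)
    have "continuous_on UNIV (\<lambda>t. cone_integral c G t (\<lambda>x. \<phi> (fst (x, t))))"
      by (intro cone_integral_continuous continuous_G
          continuous_on_compose2[OF cont[of UNIV]] continuous_intros) simp
    then have "continuous_on UNIV (\<lambda>t. w t \<phi>)"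
      unfolding w_eq[OF cont]
      by (intro continuous_intros continuous_on_compose2[OF cont[of UNIV]]) simp_all
    then show "((\<lambda>h. w (t + h) \<phi>) \<longlongrightarrow> w t \<phi>) (at 0)"
      by (simp add: continuous_on_eq_continuous_at isCont_iff)
  qed

  \<comment> \<open>The equation in the sense of distributions\<close>
  moreover have "solves_equation k c v"
    unfolding solves_equation_def
  proof (intro allI impI)
    fix \<phi> :: "real \<times> real \<Rightarrow> real" assume test: "\<phi> \<in> test_functions"
    then have \<phi>: "smooth \<phi>" by (rule test_function_smooth)
    let ?x = "dirderiv (1, 0) :: (real \<times> real \<Rightarrow> real) \<Rightarrow> real \<times> real \<Rightarrow> real"
    let ?t = "dirderiv (0, 1) :: (real \<times> real \<Rightarrow> real) \<Rightarrow> real \<times> real \<Rightarrow> real"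
    define L where "L = (\<lambda>z. ?t (?t \<phi>) z - c\<^sup>2 * ?x (?x \<phi>) z - k\<^sup>2 / 4 * \<phi> z)"
    define E where "E t = t / 2 * cone_integral c F t (\<lambda>x. ?t \<phi> (x, t))
      - ((\<phi> (c * t, t) + \<phi> (- c * t, t)) / 2 + c\<^sup>2 * t\<^sup>2 * cone_integral c G t (\<lambda>x. \<phi> (x, t)))" for t
    note smooths = \<phi> smooth_dirderiv[OF \<phi>] smooth_dirderiv[OF smooth_dirderiv[OF \<phi>]]
    have contL: "continuous_on S L" for S
      unfolding L_def by (intro continuous_intros smooth_continuous_on smooths)
    have vL: "v t (\<lambda>x. L (x, t)) = t / 2 * cone_integral c F t (\<lambda>x. L (x, t))" for t
      by (intro v_eq continuous_on_compose2[OF contL[of UNIV]] continuous_intros) simp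
    \<comment> \<open>Here the value of \<open>\<alpha>\<close> enters: it matches the zeroth-order
      term of the equation with the one produced by \<open>ode\<close>.\<close>
    have k: "k\<^sup>2 / 4 = 4 * \<alpha>\<^sup>2 * c\<^sup>2"
      using assms(2,3) by (simp add: power_divide power_mult_distrib)
    have L_lin: "cone_integral c F t (\<lambda>x. L (x, t)) =
        cone_integral c F t (\<lambda>x. ?t (?t \<phi>) (x, t)) - c\<^sup>2 * cone_integral c F t (\<lambda>x. ?x (?x \<phi>) (x, t))
        - 4 * \<alpha>\<^sup>2 * c\<^sup>2 * cone_integral c F t (\<lambda>x. \<phi> (x, t))" for t
    proof -
      have "((\<lambda>y. F (c\<^sup>2 * t\<^sup>2 * (1 - y\<^sup>2)) * q (c * t * y, t)) has_integral
          cone_integral c F t (\<lambda>x. q (x, t))) {-1..1}" if "smooth q" for q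
        unfolding cone_integral_def
        by (intro integrable_integral integrable_continuous_interval
            cone_integrand_continuous(2) continuous_F smooth_continuous_on that)
      note int = this[OF smooths(3)] this[OF smooths(3)] this[OF \<phi>]
      show ?thesis
        unfolding cone_integral_def[of c F t "\<lambda>x. L (x, t)"] k[symmetric]
        by (intro integral_unique has_integral_eq[OF _ has_integral_diff[OF has_integral_diff[OF
              int(1) has_integral_mult_right[OF int(2)]] has_integral_mult_right[OF int(3)]]])
          (simp add: L_def algebra_simps)
    qed
    \<comment> \<open>The boundary values of \<open>?t \<phi>\<close> and its cone integrals against
      \<open>G\<close> occur in both \<open>V\<close> and \<open>W\<close> and cancel; what remains
      is \<open>t / 2\<close> times the integral of \<open>L\<close> against
      \<open>F\<close>.\<close>
    have DERIV_E: "(E has_real_derivative v t (\<lambda>x. L (x, t))) (at t)" for t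
    proof -
      have V: "((\<lambda>t. t * cone_integral c F t (\<lambda>x. ?t \<phi> (x, t)) / 2) has_real_derivative
          (?t \<phi> (c * t, t) + ?t \<phi> (- c * t, t)
            + 2 * c\<^sup>2 * t\<^sup>2 * cone_integral c G t (\<lambda>x. ?t \<phi> (x, t))
            + t * cone_integral c F t (\<lambda>x. ?t (?t \<phi>) (x, t))) / 2) (at t)"
        by (rule DERIV_cdivide[OF DERIV_cone_integral[OF smooth_has_gradient[OF smooths(2)]]])
      have W: "((\<lambda>t. (\<phi> (c * t, t) + \<phi> (- c * t, t)) / 2
            + c\<^sup>2 * t\<^sup>2 * cone_integral c G t (\<lambda>x. \<phi> (x, t))) has_real_derivative
          (?t \<phi> (c * t, t) + ?t \<phi> (- c * t, t)) / 2
            + c\<^sup>2 * t\<^sup>2 * cone_integral c G t (\<lambda>x. ?t \<phi> (x, t))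
            + t / 2 * (c\<^sup>2 * cone_integral c F t (\<lambda>x. ?x (?x \<phi>) (x, t))
                       + 4 * \<alpha>\<^sup>2 * c\<^sup>2 * cone_integral c F t (\<lambda>x. \<phi> (x, t)))) (at t)"
        using assms(2)
        by (intro DERIV_cone_integral_deriv[OF _ smooth_has_gradient[OF \<phi>]
              smooth_has_gradient[OF smooths(2)]]) simp
      have "E = (\<lambda>t. t * cone_integral c F t (\<lambda>x. ?t \<phi> (x, t)) / 2
          - ((\<phi> (c * t, t) + \<phi> (- c * t, t)) / 2
            + c\<^sup>2 * t\<^sup>2 * cone_integral c G t (\<lambda>x. \<phi> (x, t))))"
        by (simp add: E_def fun_eq_iff)
      then show ?thesis
        using DERIV_diff[OF V W] unfolding vL L_lin
        by (auto elim!: DERIV_cong simp: field_simps)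
    qed
    obtain R where R: "R > 0" "\<And>z. norm z > R \<Longrightarrow> \<phi> z = 0"
      using test_function_bounded_support[OF test] by blast
    have zero: "\<phi> (x, t) = 0 \<and> ?x (?x \<phi>) (x, t) = 0 \<and> ?t \<phi> (x, t) = 0 \<and> ?t (?t \<phi>) (x, t) = 0"
      if "\<bar>t\<bar> > R" for x t
    proof -
      define U where "U = {z :: real \<times> real. \<bar>snd z\<bar> > R}"
      have U: "open U"
        unfolding U_def by (intro open_Collect_less continuous_intros)
      have 0: "\<phi> z = 0" if "z \<in> U" for z
        using that norm_snd_le[of "snd z" "fst z"] by (intro R(2)) (simp add: U_def)
      note 1 = dirderiv_eq_0[OF U 0]
      note 2 = dirderiv_eq_0[OF U 1]
      have "(x, t) \<in> U" using that by (simp add: U_def)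
      then show ?thesis by (simp add: 0 1 2)
    qed
    have L0: "v t (\<lambda>x. L (x, t)) = 0" if "\<bar>t\<bar> > R" for t
      unfolding vL cone_integral_def by (simp add: L_def zero[OF that])
    have E0: "E t = 0" if "\<bar>t\<bar> > R" for t
      unfolding E_def cone_integral_def by (simp add: zero[OF that])
    have cont_vL: "continuous_on UNIV (\<lambda>t. v t (\<lambda>x. L (x, t)))"
      unfolding vL by (intro continuous_intros cone_integral_continuous continuous_F contL) simp
    \<comment> \<open>The vanishing of \<open>E\<close> is known only strictly beyond
      \<open>R\<close>, hence the endpoints at distance \<open>R + 1\<close>.\<close>
    have "has_bochner_integral lborel
        (\<lambda>t. v t (\<lambda>x. L (x, t)) * indicator {-(R + 1)..R + 1} t) (E (R + 1) - E (-(R + 1)))"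
      using R(1) DERIV_E cont_vL
      by (intro has_bochner_integral_FTC_Icc_real) (auto simp: continuous_on_eq_continuous_at)
    moreover have "(\<lambda>t. v t (\<lambda>x. L (x, t)) * indicator {-(R + 1)..R + 1} t) = (\<lambda>t. v t (\<lambda>x. L (x, t)))"
    proof
      fix t
      show "v t (\<lambda>x. L (x, t)) * indicator {-(R + 1)..R + 1} t = v t (\<lambda>x. L (x, t))"
        using L0[of t] by (cases "\<bar>t\<bar> > R") (auto simp: indicator_def)
    qed
    ultimately have "has_bochner_integral lborel (\<lambda>t. v t (\<lambda>x. L (x, t))) 0"
      using E0[of "R + 1"] E0[of "-(R + 1)"] R(1) by simp
    then show "has_bochner_integral lborel
          (\<lambda>t. v t (\<lambda>x. (deriv ^^ 2) (\<lambda>s. \<phi> (x, s)) t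
                        - c\<^sup>2 * (deriv ^^ 2) (\<lambda>y. \<phi> (y, t)) x
                        - k\<^sup>2 / 4 * \<phi> (x, t))) 0"
      unfolding second_partials[OF \<phi>] L_def .
  qed
  moreover have "distr_eq (v 0) (\<lambda>_. 0)" and "distr_eq (w 0) (dirac 0)"
    unfolding distr_eq_def
    by (auto simp: v_eq w_eq dirac_def smooth_continuous_on[OF test_function_smooth])
  ultimately have "C1_distr v \<and> solves_ivp k c v (\<lambda>_. 0) (dirac 0) \<and> has_time_derivative v w"
    unfolding C1_distr_def solves_ivp_def by blast
  then show ?thesis unfolding v_def w_def .
qed

end
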